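(* Fix a state $x=(x_1,\dots,x_M)$. The game $(\mathcal M,\{\Pi_{\mathcal M}\}_{i\in\mathcal M},\{J_i\}_{i\in\mathcal M})$, in which each player $i\in\mathcal M=\{1,\dots,M\}$ chooses an opinion $\mathcal C_{[i]}\in\Pi_{\mathcal M}$ so as to minimize $J_i(\mathcal C_{[i]};\mathcal C_{[-i]},x)=J_i^{\mathrm{consensus}}+\rho J_i^{\mathrm{power}}$, is a finite exact potential game with potential function $$\phi(\mathcal C_{[1]},\dots,\mathcal C_{[M]})=\sum_{i\in\mathcal M}\Bigl(\tfrac12J_i^{\mathrm{consensus}}+\rho J_i^{\mathrm{power}}\Bigr).$$ Moreover, the game admits at least one Nash equilibrium, and the set of its Nash equilibria coincides with the set of Nash equilibria of the game $(\mathcal M,\{\Pi_{\mathcal M}\}_{i\in\mathcal M},\{\phi\}_{i\in\mathcal M})$ in which every player has objective $\phi$.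
   Context: A linear system $x^+=Ax+Bu$ is partitioned into $M$ subsystems with states $x_i\in\mathbb R^{n_i}$; $A=[A_{ij}]$ in block form. The neighbours of $i\in\mathcal M$ are $\mathcal M_i=\{j\in\mathcal M\setminus\{i\}:A_{ij}\neq0\}$. $\Pi_{\mathcal M}$ is the set of all set partitions of $\mathcal M$ (blocks are called coalitions). For $\mathcal C\in\Pi_{\mathcal M}$, $\delta_{ij}(\mathcal C)=\delta_{ji}(\mathcal C)=0$ if $i,j$ belong to the same block of $\mathcal C$, and $1$ otherwise. Weights: $w_{ij}(x_i,x_j)=w_{ji}(x_j,x_i)=\frac12(\|A_{ij}\||x_j|+\|A_{ji}\||x_i|)$; $\sigma_{ij}=\sigma_{ji}>0$; $\rho,\epsilon>0$. Define, with $\mathcal C_{[-i]}=\{\mathcal C_{[j]}\}_{j\in\mathcal M_i}$ the opinions of the neighbours, $$J_i^{\mathrm{consensus}}=\sum_{j\in\mathcal M_i}w_{ij}(x_i,x_j)\,|\delta_{ij}(\mathcal C_{[i]})-\delta_{ij}(\mathcal C_{[j]})|,\qquad J_i^{\mathrm{power}}=\sum_{j\in\mathcal M_i}(w_{ij}(x_i,x_j)+\epsilon)\,\sigma_{ij}\,(1-\delta_{ij}(\mathcal C_{[i]})).$$ A game with players $\mathcal M$, finite action sets $\mathcal A_i$ and objectives $T_i$ (to be minimized) is a finite exact potential game with potential $\phi$ if $T_i(a_i',a_{-i})-T_i(a_i'',a_{-i})=\phi(a_i',a_{-i})-\phi(a_i'',a_{-i})$ for all $i$, all $a_{-i}$ and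 all $a_i',a_i''\in\mathcal A_i$. A profile $a^*$ is a Nash equilibrium if $T_i(a_i^*,a_{-i}^* )=\min_{a_i\in\mathcal A_i}T_i(a_i,a_{-i}^* )$ for all $i$.
   Formalization: The neighbour relation is additionally assumed symmetric (j in M_i implies i in M_j, i.e. A_ij ≠ 0 implies A_ji ≠ 0); without this φ need not be an exact potential, e.g. M=2, A_12=1, A_21=0, x_2=1. *)

theory Defs
  imports
    "HOL-Analysis.L2_Norm"
    "HOL-Library.Disjoint_Sets"
    "Jordan_Normal_Form.Matrix"
begin

section \<open>Games with finite action sets\<close>

text \<open>
  \<open>I\<close> is the set of players, \<open>Act i\<close> the action set of player \<open>i\<close> and \<open>T i\<close> the objective that
  \<open>i\<close> minimizes. A profile is an element of \<open>Pi\<^sub>E I Act\<close>; the profile written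
  \<open>(b, a\<^sub>-\<^sub>i)\<close> in game theory is \<open>a(i := b)\<close>.
\<close>

definition finite_exact_potential_game ::
  "'i set \<Rightarrow> ('i \<Rightarrow> 'a set) \<Rightarrow> ('i \<Rightarrow> ('i \<Rightarrow> 'a) \<Rightarrow> real) \<Rightarrow> (('i \<Rightarrow> 'a) \<Rightarrow> real) \<Rightarrow> bool" where
  "finite_exact_potential_game I Act T \<phi> \<longleftrightarrow>
     finite I \<and> (\<forall>i\<in>I. finite (Act i)) \<and>
     (\<forall>i\<in>I. \<forall>a\<in>Pi\<^sub>E I Act. \<forall>a'\<in>Act i. \<forall>a''\<in>Act i.
        T i (a(i := a')) - T i (a(i := a'')) = \<phi> (a(i := a')) - \<phi> (a(i := a'')))"

definition nash_equilibrium ::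
  "'i set \<Rightarrow> ('i \<Rightarrow> 'a set) \<Rightarrow> ('i \<Rightarrow> ('i \<Rightarrow> 'a) \<Rightarrow> real) \<Rightarrow> ('i \<Rightarrow> 'a) \<Rightarrow> bool" where
  "nash_equilibrium I Act T a \<longleftrightarrow>
     a \<in> Pi\<^sub>E I Act \<and> (\<forall>i\<in>I. T i a = Min ((\<lambda>b. T i (a(i := b))) ` Act i))"


section \<open>Euclidean norm and induced matrix norm\<close>

definition vec_norm2 :: "real vec \<Rightarrow> real" where
  "vec_norm2 v = L2_set (vec_index v) {..<dim_vec v}"

definition mat_norm2 :: "real mat \<Rightarrow> real" where
  "mat_norm2 B = Sup ((\<lambda>v. vec_norm2 (B *\<^sub>v v)) ` {v \<in> carrier_vec (dim_col B). vec_norm2 v \<le> 1})"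


section \<open>The opinion game\<close>

text \<open>
  Subsystems are numbered \<open>1, \<dots>, M\<close>. Since their state dimensions differ, \<open>A i j\<close> is a matrix and
  \<open>x i\<close> a vector whose dimensions are fixed by carrier assumptions.
\<close>

definition neighbours :: "nat \<Rightarrow> (nat \<Rightarrow> nat \<Rightarrow> real mat) \<Rightarrow> nat \<Rightarrow> nat set" where
  "neighbours M A i =
     {j \<in> {1..M} - {i}. A i j \<noteq> 0\<^sub>m (dim_row (A i j)) (dim_col (A i j))}"

definition set_partitions :: "nat \<Rightarrow> nat set set set" where
  "set_partitions M = {\<C>. partition_on {1..M} \<C>}"

definition \<delta> :: "nat \<Rightarrow> nat \<Rightarrow> nat set set \<Rightarrow> real" where
  "\<delta> i j \<C> = (if \<exists>B\<in>\<C>. i \<in> B \<and> j \<in> B then 0 else 1)"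

definition weight ::
  "(nat \<Rightarrow> nat \<Rightarrow> real mat) \<Rightarrow> (nat \<Rightarrow> real vec) \<Rightarrow> nat \<Rightarrow> nat \<Rightarrow> real" where
  "weight A x i j =
     1/2 * (mat_norm2 (A i j) * vec_norm2 (x j) + mat_norm2 (A j i) * vec_norm2 (x i))"

text \<open>The profile \<open>c\<close> assigns to each subsystem \<open>i\<close> its opinion \<open>c i\<close>.\<close>

definition J_consensus ::
  "nat \<Rightarrow> (nat \<Rightarrow> nat \<Rightarrow> real mat) \<Rightarrow> (nat \<Rightarrow> real vec) \<Rightarrow> nat \<Rightarrow> (nat \<Rightarrow> nat set set) \<Rightarrow> real" where
  "J_consensus M A x i c =
     (\<Sum>j\<in>neighbours M A i. weight A x i j * \<bar>\<delta> i j (c i) - \<delta> i j (c j)\<bar>)"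

definition J_power ::
  "nat \<Rightarrow> (nat \<Rightarrow> nat \<Rightarrow> real mat) \<Rightarrow> (nat \<Rightarrow> real vec) \<Rightarrow> (nat \<Rightarrow> nat \<Rightarrow> real) \<Rightarrow> real \<Rightarrow>
   nat \<Rightarrow> (nat \<Rightarrow> nat set set) \<Rightarrow> real" where
  "J_power M A x \<sigma> \<epsilon> i c =
     (\<Sum>j\<in>neighbours M A i. (weight A x i j + \<epsilon>) * \<sigma> i j * (1 - \<delta> i j (c i)))"

definition J ::
  "nat \<Rightarrow> (nat \<Rightarrow> nat \<Rightarrow> real mat) \<Rightarrow> (nat \<Rightarrow> real vec) \<Rightarrow> (nat \<Rightarrow> nat \<Rightarrow> real) \<Rightarrow> real \<Rightarrow> real \<Rightarrow>
   nat \<Rightarrow> (nat \<Rightarrow> nat set set) \<Rightarrow> real" where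
  "J M A x \<sigma> \<epsilon> \<rho> i c = J_consensus M A x i c + \<rho> * J_power M A x \<sigma> \<epsilon> i c"

definition potential ::
  "nat \<Rightarrow> (nat \<Rightarrow> nat \<Rightarrow> real mat) \<Rightarrow> (nat \<Rightarrow> real vec) \<Rightarrow> (nat \<Rightarrow> nat \<Rightarrow> real) \<Rightarrow> real \<Rightarrow> real \<Rightarrow>
   (nat \<Rightarrow> nat set set) \<Rightarrow> real" where
  "potential M A x \<sigma> \<epsilon> \<rho> c =
     (\<Sum>i\<in>{1..M}. 1/2 * J_consensus M A x i c + \<rho> * J_power M A x \<sigma> \<epsilon> i c)"

end

theory Submission
  imports Defs
begin

text \<open>
  The weights and hence the disagreement terms are symmetric, and the neighbour relation is symmetric
  as well. So in the sum of all consensus costs every disagreement term involving player \<open>i\<close>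
  occurs exactly twice, once in the cost of \<open>i\<close> and once in that of the neighbour; the factor
  \<open>1/2\<close> turns these into one copy of the consensus cost of \<open>i\<close>. The power terms decouple, so the
  potential is \<open>J\<^sub>i\<close> plus a term that does not depend on the opinion of \<open>i\<close>. A minimizer of the
  potential over the finite set of profiles is a Nash equilibrium.
\<close>

text \<open>Player \<open>i\<close>'s current action lies in \<open>Act i\<close>, and deviating to
  it gives back \<open>a\<close>. So \<open>T i a\<close> is among the values minimized over and
  equals \<open>Min\<close> exactly when it is a lower bound.\<close>

lemma nash_equilibrium_iff:
  assumes "\<And>i. i \<in> I \<Longrightarrow> finite (Act i)"
  shows "nash_equilibrium I Act T a \<longleftrightarrow>
    a \<in> Pi\<^sub>E I Act \<and> (\<forall>i\<in>I. \<forall>b\<in>Act i. T i a \<le> T i (a(i := b)))"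
proof -
  have "T i a = Min ((\<lambda>b. T i (a(i := b))) ` Act i) \<longleftrightarrow> (\<forall>b\<in>Act i. T i a \<le> T i (a(i := b)))"
    if "a \<in> Pi\<^sub>E I Act" "i \<in> I" for i
  proof -
    have "a i \<in> Act i"
      using that by auto
    then have "T i a \<in> (\<lambda>b. T i (a(i := b))) ` Act i"
      by (intro image_eqI[where x = "a i"]) auto
    then show ?thesis
      using assms[OF \<open>i \<in> I\<close>] by (subst eq_commute, subst Min_eq_iff) auto
  qed
  then show ?thesis
    unfolding nash_equilibrium_def by blast
qed

text \<open>A unilateral deviation changes the player's objective and the potential by the same
  amount, so the same deviations are profitable in both games.\<close>

lemma exact_potential_game_nash_iff:
  assumes "finite_exact_potential_game I Act T \<phi>"
  shows "nash_equilibrium I Act T a \<longleftrightarrow> nash_equilibrium I Act (\<lambda>_. \<phi>) a"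
proof -
  have fin: "\<And>i. i \<in> I \<Longrightarrow> finite (Act i)"
    using assms by (simp add: finite_exact_potential_game_def)
  have "T i a \<le> T i (a(i := b)) \<longleftrightarrow> \<phi> a \<le> \<phi> (a(i := b))"
    if "a \<in> Pi\<^sub>E I Act" "i \<in> I" "b \<in> Act i" for i b
  proof -
    have "a i \<in> Act i"
      using that by auto
    \<comment> \<open>Exactness compares two replaced actions; choosing \<open>a i\<close> as the
      first makes one of the two profiles \<open>a\<close> itself.\<close>
    then have "T i (a(i := a i)) - T i (a(i := b)) = \<phi> (a(i := a i)) - \<phi> (a(i := b))"
      using assms that unfolding finite_exact_potential_game_def by blast
    then show ?thesis
      by (simp, linarith)
  qed
  then show ?thesis
    by (auto simp: nash_equilibrium_iff[OF fin])
qed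

lemma exact_potential_game_nash_exists:
  assumes game: "finite_exact_potential_game I Act T \<phi>"
    and nonempty: "\<And>i. i \<in> I \<Longrightarrow> Act i \<noteq> {}"
  shows "\<exists>a. nash_equilibrium I Act T a"
proof -
  have fin: "finite I" "\<And>i. i \<in> I \<Longrightarrow> finite (Act i)"
    using game by (simp_all add: finite_exact_potential_game_def)
  have "finite (Pi\<^sub>E I Act)" "Pi\<^sub>E I Act \<noteq> {}"
    using fin nonempty by (auto intro: finite_PiE simp: PiE_eq_empty_iff)
  then obtain a where a: "a \<in> Pi\<^sub>E I Act" "\<And>b. b \<in> Pi\<^sub>E I Act \<Longrightarrow> \<phi> a \<le> \<phi> b"
    by (metis arg_min_if_finite(1) arg_min_least)
  \<comment> \<open>A deviation is again a profile, so the global minimality of \<open>a\<close>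
    applies to it.\<close>
  have "a(i := b) \<in> Pi\<^sub>E I Act" if "i \<in> I" "b \<in> Act i" for i b
    using a(1) that PiE_fun_upd[of b Act i a I] by (simp add: insert_absorb)
  then have "nash_equilibrium I Act (\<lambda>_. \<phi>) a"
    using a by (simp add: nash_equilibrium_iff[OF fin(2)])
  then show ?thesis
    using exact_potential_game_nash_iff[OF game] by blast
qed

text \<open>The remainder \<open>R i\<close> ignores the action of \<open>i\<close>, so it cancels
  when two deviations of \<open>i\<close> are compared.\<close>

lemma finite_exact_potential_gameI:
  assumes "finite I" "\<And>i. i \<in> I \<Longrightarrow> finite (Act i)"
    and "\<And>i a. i \<in> I \<Longrightarrow> \<phi> a = T i a + R i a"
    and "\<And>i a b. i \<in> I \<Longrightarrow> R i (a(i := b)) = R i a"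
  shows "finite_exact_potential_game I Act T \<phi>"
  using assms by (simp add: finite_exact_potential_game_def)

lemma finite_set_partitions: "finite (set_partitions M)"
  unfolding set_partitions_def by (rule finitely_many_partition_on) simp

lemma set_partitions_nonempty: "set_partitions M \<noteq> {}"
  unfolding set_partitions_def using partition_on_singletons by blast

lemma \<delta>_commute: "\<delta> i j C = \<delta> j i C"
  unfolding \<delta>_def by meson

text \<open>The cost of a single edge, isolated because it is symmetric in its endpoints and reads
  \<open>c\<close> only there.\<close>

definition disagreement ::
  "(nat \<Rightarrow> nat \<Rightarrow> real mat) \<Rightarrow> (nat \<Rightarrow> real vec) \<Rightarrow> (nat \<Rightarrow> nat set set) \<Rightarrow> nat \<Rightarrow> nat \<Rightarrow> real" where
  "disagreement A x c i j = weight A x i j * \<bar>\<delta> i j (c i) - \<delta> i j (c j)\<bar>"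

lemma disagreement_commute: "disagreement A x c i j = disagreement A x c j i"
  by (simp add: disagreement_def weight_def \<delta>_commute[of i j] abs_minus_commute add.commute)

lemma J_consensus_eq: "J_consensus M A x i c = (\<Sum>j\<in>neighbours M A i. disagreement A x c i j)"
  by (simp add: J_consensus_def disagreement_def)

text \<open>The outer index \<open>k = i\<close> yields one copy of the sum over \<open>N i\<close>.
  The edges that lead into \<open>i\<close> from the other vertices yield a second copy, by the
  symmetry of \<open>N\<close> and \<open>f\<close>. What is left avoids \<open>i\<close>
  altogether.\<close>

lemma sum_symmetric_neighbours:
  fixes f :: "'a \<Rightarrow> 'a \<Rightarrow> 'b::comm_semiring_1"
  assumes "finite V" "i \<in> V"
    and N: "\<And>k. k \<in> V \<Longrightarrow> N k \<subseteq> V - {k}"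
    and sym: "\<And>k. k \<in> V \<Longrightarrow> i \<in> N k \<longleftrightarrow> k \<in> N i"
    and f: "\<And>k. f k i = f i k"
  shows "(\<Sum>k\<in>V. \<Sum>j\<in>N k. f k j) = 2 * (\<Sum>j\<in>N i. f i j) + (\<Sum>k\<in>V-{i}. \<Sum>j\<in>N k-{i}. f k j)"
proof -
  have fin: "finite (N k)" if "k \<in> V" for k
    using N[OF that] \<open>finite V\<close> by (meson finite_Diff finite_subset)
  have "(\<Sum>k\<in>V-{i}. \<Sum>j\<in>N k. f k j)
      = (\<Sum>k\<in>V-{i}. (if k \<in> N i then f i k else 0) + (\<Sum>j\<in>N k-{i}. f k j))"
    using fin sym f by (intro sum.cong) (auto simp: sum.remove[where x = i])
  also have "\<dots> = (\<Sum>k\<in>V-{i}. if k \<in> N i then f i k else 0) + (\<Sum>k\<in>V-{i}. \<Sum>j\<in>N k-{i}. f k j)"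
    by (rule sum.distrib)
  \<comment> \<open>As \<open>N i\<close> lies inside \<open>V - {i}\<close>, the indicator cuts the
    sum down to exactly \<open>N i\<close>.\<close>
  also have "(\<Sum>k\<in>V-{i}. if k \<in> N i then f i k else 0) = (\<Sum>k\<in>N i. f i k)"
    using N[OF \<open>i \<in> V\<close>] \<open>finite V\<close> by (subst sum.inter_restrict[symmetric]) (auto simp: Int_absorb1)
  finally show ?thesis
    using \<open>finite V\<close> \<open>i \<in> V\<close> by (simp add: sum.remove[of V i] algebra_simps mult_2)
qed

text \<open>The consensus part keeps only edges with both ends different from \<open>i\<close>. The
  power cost of another player \<open>k\<close> may include an edge to \<open>i\<close>, but it
  evaluates that edge in the opinion \<open>c k\<close> alone.\<close>

definition potential_rest ::
  "nat \<Rightarrow> (nat \<Rightarrow> nat \<Rightarrow> real mat) \<Rightarrow> (nat \<Rightarrow> real vec) \<Rightarrow> (nat \<Rightarrow> nat \<Rightarrow> real) \<Rightarrow> real \<Rightarrow> real \<Rightarrow>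
   nat \<Rightarrow> (nat \<Rightarrow> nat set set) \<Rightarrow> real" where
  "potential_rest M A x \<sigma> \<epsilon> \<rho> i c =
     1/2 * (\<Sum>k\<in>{1..M}-{i}. \<Sum>j\<in>neighbours M A k-{i}. disagreement A x c k j)
     + \<rho> * (\<Sum>k\<in>{1..M}-{i}. J_power M A x \<sigma> \<epsilon> k c)"

lemma potential_rest_fun_upd:
  "potential_rest M A x \<sigma> \<epsilon> \<rho> i (c(i := b)) = potential_rest M A x \<sigma> \<epsilon> \<rho> i c"
  unfolding potential_rest_def
  by (intro arg_cong2[where f = "(+)"] arg_cong2[where f = "(*)"] sum.cong refl)
     (auto simp: disagreement_def J_power_def)

text \<open>Symmetry of the neighbour relation is essential here: an edge listed by only one
  endpoint would occur once in the double sum, and the factor 1/2 would leave half of that player's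
  consensus term.\<close>

lemma potential_eq_J_plus_rest:
  assumes "\<And>i j. i \<in> {1..M} \<Longrightarrow> j \<in> neighbours M A i \<Longrightarrow> i \<in> neighbours M A j"
    and i: "i \<in> {1..M}"
  shows "potential M A x \<sigma> \<epsilon> \<rho> c = J M A x \<sigma> \<epsilon> \<rho> i c + potential_rest M A x \<sigma> \<epsilon> \<rho> i c"
proof -
  have "(\<Sum>k\<in>{1..M}. J_consensus M A x k c) = 2 * J_consensus M A x i c
      + (\<Sum>k\<in>{1..M}-{i}. \<Sum>j\<in>neighbours M A k-{i}. disagreement A x c k j)"
    unfolding J_consensus_eq
  proof (rule sum_symmetric_neighbours)
    show "neighbours M A k \<subseteq> {1..M} - {k}" for k
      by (auto simp: neighbours_def)
  qed (use assms in \<open>auto simp: disagreement_commute\<close>)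
  moreover have "(\<Sum>k\<in>{1..M}. J_power M A x \<sigma> \<epsilon> k c)
      = J_power M A x \<sigma> \<epsilon> i c + (\<Sum>k\<in>{1..M}-{i}. J_power M A x \<sigma> \<epsilon> k c)"
    using i by (simp add: sum.remove)
  ultimately show ?thesis
    unfolding potential_def J_def potential_rest_def sum.distrib sum_distrib_left[symmetric]
    by (simp only: algebra_simps)
qed

theorem theorem4p1:
  fixes M :: nat and n :: "nat \<Rightarrow> nat"
    and A :: "nat \<Rightarrow> nat \<Rightarrow> real mat" and x :: "nat \<Rightarrow> real vec"
    and \<sigma> :: "nat \<Rightarrow> nat \<Rightarrow> real" and \<epsilon> \<rho> :: real
  assumes blocks: "\<And>i j. i \<in> {1..M} \<Longrightarrow> j \<in> {1..M} \<Longrightarrow> A i j \<in> carrier_mat (n i) (n j)"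
    and state: "\<And>i. i \<in> {1..M} \<Longrightarrow> x i \<in> carrier_vec (n i)"
    and bidirectional: "\<And>i j. i \<in> {1..M} \<Longrightarrow> j \<in> neighbours M A i \<Longrightarrow> i \<in> neighbours M A j"
    and sigma: "\<And>i j. i \<in> {1..M} \<Longrightarrow> j \<in> {1..M} \<Longrightarrow> i \<noteq> j \<Longrightarrow> \<sigma> i j = \<sigma> j i \<and> \<sigma> i j > 0"
    and "\<rho> > 0" and "\<epsilon> > 0"
  shows "finite_exact_potential_game {1..M} (\<lambda>_. set_partitions M)
           (J M A x \<sigma> \<epsilon> \<rho>) (potential M A x \<sigma> \<epsilon> \<rho>)
       \<and> (\<exists>c. nash_equilibrium {1..M} (\<lambda>_. set_partitions M) (J M A x \<sigma> \<epsilon> \<rho>) c)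
       \<and> {c. nash_equilibrium {1..M} (\<lambda>_. set_partitions M) (J M A x \<sigma> \<epsilon> \<rho>) c}
         = {c. nash_equilibrium {1..M} (\<lambda>_. set_partitions M) (\<lambda>_. potential M A x \<sigma> \<epsilon> \<rho>) c}"
proof -
  have game: "finite_exact_potential_game {1..M} (\<lambda>_. set_partitions M)
      (J M A x \<sigma> \<epsilon> \<rho>) (potential M A x \<sigma> \<epsilon> \<rho>)"
    using potential_eq_J_plus_rest[OF bidirectional] finite_set_partitions potential_rest_fun_upd
    by (intro finite_exact_potential_gameI[where R = "potential_rest M A x \<sigma> \<epsilon> \<rho>"]) blast+
  then show ?thesis
    using exact_potential_game_nash_iff[OF game]
      exact_potential_game_nash_exists[OF game set_partitions_nonempty] by blast
qed

end
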